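(* For all positive integers $m,k,n$ such that $2<k\leq n$ and $1\leq m\leq k$, $$|S_n(T_k^m)|=(k-2)!\cdot(k-1)^{n+2-k}.$$
   Context: $S_n$ denotes the set of all permutations $\alpha=(\alpha_1,\dots,\alpha_n)$ of $\{1,\dots,n\}$, written in one-line notation. For $1\leq m\leq k$, $T_k^m=\{\sigma\in S_k\mid\sigma_1=m\}$ is the set of permutations of $\{1,\dots,k\}$ whose first entry is $m$. A permutation $\alpha\in S_n$ avoids a permutation (pattern) $\tau\in S_k$ if there are no indices $1\leq i_1<\dots<i_k\leq n$ such that $(\alpha_{i_1},\dots,\alpha_{i_k})$ is order-isomorphic to $(\tau_1,\dots,\tau_k)$ (i.e. $\alpha_{i_a}<\alpha_{i_b}$ if and only if $\tau_a<\tau_b$). For a set of patterns $T$, $S_n(T)$ denotes the set of all $\alpha\in S_n$ that avoid every $\tau\in T$. *)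

theory Defs
  imports "HOL-Combinatorics.Multiset_Permutations"
begin

text \<open>
  A permutation is represented by its one-line notation, a list. The values are
  1, ..., n as usual, whereas list positions are counted from 0.
\<close>

definition Sym :: "nat \<Rightarrow> nat list set" where
  "Sym n = permutations_of_set {1..n}"

definition first_entry_patterns :: "nat \<Rightarrow> nat \<Rightarrow> nat list set" where
  "first_entry_patterns k m = {\<sigma> \<in> Sym k. \<sigma> ! 0 = m}"

text \<open>
  The function \<open>i\<close> is the choice of positions
  \<open>i 0 < ... < i (k - 1)\<close> in \<open>\<alpha>\<close>; its values
  outside \<open>{..<k}\<close> are irrelevant.
\<close>

definition avoids :: "nat list \<Rightarrow> nat list \<Rightarrow> bool" where
  "avoids \<alpha> \<tau> \<longleftrightarrow>
     \<not> (\<exists>i :: nat \<Rightarrow> nat.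
           strict_mono_on {..<length \<tau>} i \<and>
           (\<forall>a<length \<tau>. i a < length \<alpha>) \<and>
           (\<forall>a<length \<tau>. \<forall>b<length \<tau>. \<alpha> ! i a < \<alpha> ! i b \<longleftrightarrow> \<tau> ! a < \<tau> ! b))"

definition Sym_avoiding :: "nat \<Rightarrow> nat list set \<Rightarrow> nat list set" where
  "Sym_avoiding n T = {\<alpha> \<in> Sym n. \<forall>\<tau>\<in>T. avoids \<alpha> \<tau>}"

end

theory Submission
  imports Defs
begin

text \<open>
  An entry of a permutation is the first entry of an occurrence of some pattern in
  \<^term>\<open>first_entry_patterns k m\<close> if and only if at least \<open>m - 1\<close> smaller
  and at least \<open>k - m\<close> larger entries come after it: since every arrangement of the
  remaining \<open>k - 1\<close> letters is among the patterns, any choice of \<open>m - 1\<close> smaller and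
  \<open>k - m\<close> larger later entries completes an occurrence (lemma
  \<open>avoids_first_entry_patterns_iff\<close>). Avoidance is therefore a condition on each entry
  and the set of entries after it, and does not involve the order of the latter.

  Now build the permutation from left to right. When \<open>j\<close> values are left, the next one
  must be among the \<open>m - 1\<close> smallest or among the \<open>k - m\<close> largest of them, which leaves
  \<open>min j (k - 1)\<close> choices (lemma \<open>card_extremal\<close>), whatever was chosen before. The
  number of avoiding permutations is thus \<open>\<Prod>j = 1..n. min j (k - 1)\<close>, that is
  \<open>(k - 1)! (k - 1) ^ (n + 1 - k)\<close>.
\<close>

section \<open>Ranks in a finite linear order\<close>

lemma rank_less_iff:
  fixes A :: "'a::linorder set"
  assumes "finite A" "x \<in> A" "y \<in> A"
  shows "card {z \<in> A. z < x} < card {z \<in> A. z < y} \<longleftrightarrow> x < y"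
proof
  assume "x < y"
  then have "{z \<in> A. z < x} \<subset> {z \<in> A. z < y}"
    using assms(2) by auto
  then show "card {z \<in> A. z < x} < card {z \<in> A. z < y}"
    using assms(1) by (intro psubset_card_mono) auto
next
  assume less: "card {z \<in> A. z < x} < card {z \<in> A. z < y}"
  show "x < y"
  proof (rule ccontr)
    assume "\<not> x < y"
    then have "{z \<in> A. z < y} \<subseteq> {z \<in> A. z < x}"
      by auto
    then have "card {z \<in> A. z < y} \<le> card {z \<in> A. z < x}"
      using assms(1) by (intro card_mono) auto
    with less show False
      by simp
  qed
qed

lemma bij_betw_rank:
  fixes A :: "'a::linorder set"
  assumes "finite A"
  shows "bij_betw (\<lambda>x. card {y \<in> A. y < x}) A {..<card A}"
proof -
  let ?r = "\<lambda>x. card {y \<in> A. y < x}"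
  have inj: "inj_on ?r A"
  proof (rule inj_onI)
    fix x y assume "x \<in> A" "y \<in> A" "?r x = ?r y"
    then have "\<not> x < y" "\<not> y < x"
      using rank_less_iff[OF assms, of x y] rank_less_iff[OF assms, of y x] by simp_all
    then show "x = y"
      by simp
  qed
  have "?r ` A \<subseteq> {..<card A}"
    using assms by (auto intro!: psubset_card_mono simp: psubset_eq)
  then have "?r ` A = {..<card A}"
    by (intro card_subset_eq) (auto simp: card_image inj)
  with inj show ?thesis
    by (simp add: bij_betw_def)
qed

text \<open>
  Passing to ranks replaces \<open>A\<close> by \<open>{..<card A}\<close>, where the elements in question are
  the numbers below \<open>a\<close> and the last \<open>b\<close> numbers. These exhaust the interval when
  \<open>card A \<le> a + b\<close> and are disjoint otherwise, whence the minimum.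
\<close>

lemma card_extremal:
  fixes A :: "'a::linorder set"
  assumes "finite A"
  shows "card {x \<in> A. card {y \<in> A. y < x} < a \<or> card {y \<in> A. x < y} < b} = min (card A) (a + b)"
proof -
  let ?r = "\<lambda>x. card {y \<in> A. y < x}"
  let ?C = "{x \<in> A. card {y \<in> A. y < x} < a \<or> card {y \<in> A. x < y} < b}"
  have above: "card {y \<in> A. x < y} = card A - 1 - ?r x" if "x \<in> A" for x
  proof -
    have "A - {x} = {y \<in> A. y < x} \<union> {y \<in> A. x < y}"
      by auto
    moreover have "card ({y \<in> A. y < x} \<union> {y \<in> A. x < y}) = ?r x + card {y \<in> A. x < y}"
      using assms by (intro card_Un_disjoint) auto
    ultimately have "card A - 1 = ?r x + card {y \<in> A. x < y}"
      using card_Diff_singleton[OF that] by (simp only:)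
    then show ?thesis
      by linarith
  qed
  have bij: "bij_betw ?r A {..<card A}"
    by (rule bij_betw_rank[OF assms])
  have img: "?r ` A = {..<card A}"
    using bij by (simp add: bij_betw_def)
  have "?C = {x \<in> A. ?r x < a \<or> card A - 1 - ?r x < b}"
    using above by auto
  then have "?r ` ?C = {r \<in> ?r ` A. r < a \<or> card A - 1 - r < b}"
    by auto
  also have "\<dots> = {..<min a (card A)} \<union> {max (min a (card A)) (card A - b)..<card A}"
    unfolding img by auto
  finally have "?r ` ?C = \<dots>" .
  moreover have "card (?r ` ?C) = card ?C"
    using bij by (intro card_image) (auto simp: bij_betw_def intro: inj_on_subset)
  moreover have "card ({..<min a (card A)} \<union> {max (min a (card A)) (card A - b)..<card A})
      = min (card A) (a + b)"
    by (subst card_Un_disjoint) auto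
  ultimately show ?thesis
    by simp
qed

section \<open>Counting by the choice of the first entry\<close>

fun uncrowded :: "nat \<Rightarrow> nat \<Rightarrow> 'a::linorder list \<Rightarrow> bool" where
  "uncrowded a b [] \<longleftrightarrow> True"
| "uncrowded a b (x # xs) \<longleftrightarrow>
     (card {y \<in> set xs. y < x} < a \<or> card {y \<in> set xs. x < y} < b) \<and> uncrowded a b xs"

lemma card_uncrowded_permutations:
  fixes A :: "'a::linorder set"
  assumes "finite A"
  shows "card {xs \<in> permutations_of_set A. uncrowded a b xs} = (\<Prod>j = 1..card A. min j (a + b))"
  using assms
proof (induction "card A" arbitrary: A)
  case 0
  then have "{xs \<in> permutations_of_set A. uncrowded a b xs} = {[]}"
    by auto
  then show ?case
    using 0 by simp
next
  case (Suc l)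
  let ?U = "\<lambda>B. {xs \<in> permutations_of_set B. uncrowded a b xs}"
  define C where "C = {x \<in> A. card {y \<in> A. y < x} < a \<or> card {y \<in> A. x < y} < b}"
  have "finite C"
    using Suc.prems by (simp add: C_def)
  have "A \<noteq> {}"
    using Suc.hyps(2) by auto
  have first: "uncrowded a b (x # xs) \<longleftrightarrow> x \<in> C \<and> uncrowded a b xs"
    if "x \<in> A" "xs \<in> permutations_of_set (A - {x})" for x xs
  proof -
    have "set xs = A - {x}"
      using that(2) by (simp add: permutations_of_set_def)
    then have "{y \<in> set xs. y < x} = {y \<in> A. y < x}" "{y \<in> set xs. x < y} = {y \<in> A. x < y}"
      by auto
    then show ?thesis
      using that(1) by (simp add: C_def)
  qed
  have "?U A = (\<Union>x\<in>C. (#) x ` ?U (A - {x}))"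
  proof -
    have "?U A = (\<Union>x\<in>A. (#) x ` {xs \<in> permutations_of_set (A - {x}). uncrowded a b (x # xs)})"
      unfolding permutations_of_set_nonempty[OF \<open>A \<noteq> {}\<close>] by blast
    also have "\<dots> = (\<Union>x\<in>A. (#) x ` {xs \<in> permutations_of_set (A - {x}). x \<in> C \<and> uncrowded a b xs})"
      using first by blast
    also have "\<dots> = (\<Union>x\<in>C. (#) x ` ?U (A - {x}))"
      by (auto simp: C_def)
    finally show ?thesis .
  qed
  then have "card (?U A) = (\<Sum>x\<in>C. card ((#) x ` ?U (A - {x})))"
    using \<open>finite C\<close> by (simp only:) (subst card_UN_disjoint; auto)
  also have "\<dots> = (\<Sum>x\<in>C. \<Prod>j = 1..l. min j (a + b))"
  proof (rule sum.cong[OF refl])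
    fix x assume "x \<in> C"
    then have "card (A - {x}) = l"
      using Suc.hyps(2) Suc.prems by (auto simp: C_def)
    then show "card ((#) x ` ?U (A - {x})) = (\<Prod>j = 1..l. min j (a + b))"
      using Suc.hyps(1)[of "A - {x}"] Suc.prems by (simp add: card_image)
  qed
  also have "\<dots> = (\<Prod>j = 1..Suc l. min j (a + b))"
    using card_extremal[OF Suc.prems, of a b] by (simp add: C_def Suc.hyps(2)[symmetric] mult.commute)
  finally show ?case
    by (simp only: Suc.hyps(2))
qed

lemma prod_min_eq:
  fixes c n :: nat
  assumes "c \<le> n"
  shows "(\<Prod>j = 1..n. min j c) = fact c * c ^ (n - c)"
  using assms
proof (induction n rule: dec_induct)
  case base
  have "(\<Prod>j = 1..c. min j c) = \<Prod>{1..c}"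
    by (rule prod.cong) auto
  then show ?case
    by (simp add: fact_prod)
next
  case (step n)
  then show ?case
    by (simp add: Suc_diff_le)
qed

section \<open>Avoidance as a condition on each entry\<close>

lemma uncrowded_iff_nth:
  assumes "distinct xs"
  shows "uncrowded a b xs \<longleftrightarrow>
    (\<forall>p<length xs. card {q. p < q \<and> q < length xs \<and> xs ! q < xs ! p} < a \<or>
                    card {q. p < q \<and> q < length xs \<and> xs ! p < xs ! q} < b)"
  using assms
proof (induction xs)
  case Nil
  then show ?case by simp
next
  case (Cons x xs)
  have head: "card {q. 0 < q \<and> q < length (x # xs) \<and> P ((x # xs) ! q)} = card {y \<in> set xs. P y}" for P
  proof -
    have "{q. 0 < q \<and> q < length (x # xs) \<and> P ((x # xs) ! q)} = Suc ` {q. q < length xs \<and> P (xs ! q)}"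
      by (auto simp: image_iff gr0_conv_Suc)
    moreover have "{y \<in> set xs. P y} = (!) xs ` {q. q < length xs \<and> P (xs ! q)}"
      by (auto simp: in_set_conv_nth)
    moreover have "inj_on ((!) xs) {q. q < length xs \<and> P (xs ! q)}"
      using Cons.prems by (auto intro: inj_on_nth)
    ultimately show ?thesis
      by (simp add: card_image)
  qed
  have tail: "card {q. Suc p < q \<and> q < length (x # xs) \<and> P ((x # xs) ! q)}
      = card {q. p < q \<and> q < length xs \<and> P (xs ! q)}" for p P
  proof -
    have "{q. Suc p < q \<and> q < length (x # xs) \<and> P ((x # xs) ! q)}
        = Suc ` {q. p < q \<and> q < length xs \<and> P (xs ! q)}"
      by (auto simp: image_iff Suc_less_eq2)
    then show ?thesis
      by (simp add: card_image)
  qed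
  note counts = head[of "\<lambda>y. y < c" for c] head[of "\<lambda>y. c < y" for c]
    tail[of _ "\<lambda>y. y < c" for c] tail[of _ "\<lambda>y. c < y" for c]
  have "(\<forall>p<length (x # xs). P p) \<longleftrightarrow> P 0 \<and> (\<forall>p<length xs. P (Suc p))" for P
    by (simp add: All_less_Suc2)
  then show ?case
    using Cons by (simp only: uncrowded.simps counts nth_Cons_0 nth_Cons_Suc distinct.simps)
qed

text \<open>
  The standardization of a list, which replaces each entry by its rank, is the pattern that
  the list realizes.
\<close>

definition standardize :: "'a::linorder list \<Rightarrow> nat list" where
  "standardize ys = map (\<lambda>y. Suc (card {z \<in> set ys. z < y})) ys"

lemma standardize_in_Sym:
  assumes "distinct ys"
  shows "standardize ys \<in> Sym (length ys)"
proof -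
  have bij: "bij_betw (\<lambda>y. card {z \<in> set ys. z < y}) (set ys) {..<length ys}"
    using bij_betw_rank[of "set ys"] assms by (simp add: distinct_card)
  have "distinct (standardize ys)"
    using assms bij by (auto simp: standardize_def distinct_map bij_betw_def inj_on_def)
  moreover have "set (standardize ys) = Suc ` ((\<lambda>y. card {z \<in> set ys. z < y}) ` set ys)"
    by (simp add: standardize_def image_image)
  then have "set (standardize ys) = {1..length ys}"
    using bij by (simp add: bij_betw_def image_Suc_lessThan)
  ultimately show ?thesis
    by (simp add: Sym_def permutations_of_set_def)
qed

lemma standardize_less_iff:
  "i < length ys \<Longrightarrow> j < length ys \<Longrightarrow> standardize ys ! i < standardize ys ! j \<longleftrightarrow> ys ! i < ys ! j"
  by (simp add: standardize_def rank_less_iff)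

text \<open>
  An occurrence sends the positions of the letters below and above the first letter \<open>m\<close> to
  later positions with smaller and larger entries.
\<close>

lemma occurrence_imp_crowded:
  assumes \<tau>: "\<tau> \<in> first_entry_patterns k m" and "1 \<le> m" "m \<le> k" and "\<not> avoids \<alpha> \<tau>"
  obtains p where "p < length \<alpha>"
    and "m - 1 \<le> card {q. p < q \<and> q < length \<alpha> \<and> \<alpha> ! q < \<alpha> ! p}"
    and "k - m \<le> card {q. p < q \<and> q < length \<alpha> \<and> \<alpha> ! p < \<alpha> ! q}"
proof -
  have d: "distinct \<tau>" and s: "set \<tau> = {1..k}" and first: "\<tau> ! 0 = m"
    using \<tau> by (auto simp: first_entry_patterns_def Sym_def permutations_of_set_def)
  have len: "length \<tau> = k"
    using distinct_card[OF d] s by simp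
  obtain i where mono: "strict_mono_on {..<k} i" and bound: "\<And>a. a < k \<Longrightarrow> i a < length \<alpha>"
    and iso: "\<And>a b. a < k \<Longrightarrow> b < k \<Longrightarrow> \<alpha> ! i a < \<alpha> ! i b \<longleftrightarrow> \<tau> ! a < \<tau> ! b"
    using assms(4) unfolding avoids_def len by blast
  have "0 < k"
    using assms by simp
  have inj: "inj_on i {..<k}"
    by (rule strict_mono_on_imp_inj_on[OF mono])
  have count: "card {y \<in> {1..k}. P y} \<le> card {q. i 0 < q \<and> q < length \<alpha> \<and> Q q}"
    if "\<not> P m" and "\<And>a. a < k \<Longrightarrow> P (\<tau> ! a) \<Longrightarrow> Q (i a)" for P Q
  proof -
    let ?J = "{a. a < k \<and> P (\<tau> ! a)}"
    have "{y \<in> {1..k}. P y} = (!) \<tau> ` ?J"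
      unfolding s[symmetric] by (auto simp: in_set_conv_nth len)
    then have "card {y \<in> {1..k}. P y} \<le> card ?J"
      by (simp add: card_image_le)
    also have "card ?J = card (i ` ?J)"
      using inj by (intro card_image[symmetric]) (auto intro: inj_on_subset)
    also have "\<dots> \<le> card {q. i 0 < q \<and> q < length \<alpha> \<and> Q q}"
    proof (intro card_mono subsetI)
      fix q assume "q \<in> i ` ?J"
      then obtain a where a: "a < k" "P (\<tau> ! a)" "q = i a"
        by auto
      then have "0 < a"
        using that(1) first by (cases a) auto
      then have "i 0 < i a"
        using a(1) mono \<open>0 < k\<close> by (auto intro: strict_mono_onD)
      then show "q \<in> {q. i 0 < q \<and> q < length \<alpha> \<and> Q q}"
        using a that(2) bound by auto
    qed simp
    finally show ?thesis .
  qed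
  have "{y \<in> {1..k}. y < m} = {1..<m}" "{y \<in> {1..k}. m < y} = {m<..k}"
    using assms(2,3) by auto
  then have "m - 1 \<le> card {q. i 0 < q \<and> q < length \<alpha> \<and> \<alpha> ! q < \<alpha> ! i 0}"
    and "k - m \<le> card {q. i 0 < q \<and> q < length \<alpha> \<and> \<alpha> ! i 0 < \<alpha> ! q}"
    using count[of "\<lambda>y. y < m" "\<lambda>q. \<alpha> ! q < \<alpha> ! i 0"]
      count[of "\<lambda>y. m < y" "\<lambda>q. \<alpha> ! i 0 < \<alpha> ! q"] iso \<open>0 < k\<close> first by auto
  then show thesis
    using that bound \<open>0 < k\<close> by blast
qed

text \<open>
  Conversely, \<open>m - 1\<close> smaller and \<open>k - m\<close> larger entries after position \<open>p\<close> form, together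
  with the entry at \<open>p\<close>, a subsequence of length \<open>k\<close> whose first entry is its \<open>m\<close>-th
  smallest. Its standardization is the pattern wanted.
\<close>

lemma crowded_imp_occurrence:
  assumes "distinct \<alpha>" and "1 \<le> m" "m \<le> k" and "p < length \<alpha>"
    and "m - 1 \<le> card {q. p < q \<and> q < length \<alpha> \<and> \<alpha> ! q < \<alpha> ! p}"
    and "k - m \<le> card {q. p < q \<and> q < length \<alpha> \<and> \<alpha> ! p < \<alpha> ! q}"
  obtains \<tau> where "\<tau> \<in> first_entry_patterns k m" and "\<not> avoids \<alpha> \<tau>"
proof -
  obtain S where S: "S \<subseteq> {q. p < q \<and> q < length \<alpha> \<and> \<alpha> ! q < \<alpha> ! p}" "card S = m - 1" "finite S"
    using obtain_subset_with_card_n[OF assms(5)] by blast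
  obtain G where G: "G \<subseteq> {q. p < q \<and> q < length \<alpha> \<and> \<alpha> ! p < \<alpha> ! q}" "card G = k - m" "finite G"
    using obtain_subset_with_card_n[OF assms(6)] by blast
  have "S \<inter> G = {}"
    using S(1) G(1) by fastforce
  define js where "js = p # sorted_list_of_set (S \<union> G)"
  define ys where "ys = map ((!) \<alpha>) js"
  have set_js: "set js = insert p (S \<union> G)"
    using S G by (simp add: js_def)
  have len: "length js = k"
    using S G \<open>S \<inter> G = {}\<close> assms(2,3) by (simp add: js_def card_Un_disjoint)
  have sorted: "sorted_wrt (<) js"
    using S G by (auto simp: js_def strict_sorted_list_of_set)
  have js_bound: "set js \<subseteq> {..<length \<alpha>}"
    using S G assms(4) by (auto simp: set_js)
  have inj: "inj_on ((!) \<alpha>) (set js)"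
    using assms(1) js_bound by (auto intro!: inj_on_nth)
  have "distinct ys"
    using inj strict_sorted_iff[of js] sorted by (simp add: ys_def distinct_map)
  have len_ys: "length ys = k"
    by (simp add: ys_def len)
  have "{z \<in> set ys. z < \<alpha> ! p} = (!) \<alpha> ` S"
    using S(1) G(1) by (auto simp: ys_def set_js)
  moreover have "inj_on ((!) \<alpha>) S"
    by (rule inj_on_subset[OF inj]) (auto simp: set_js)
  ultimately have "card {z \<in> set ys. z < \<alpha> ! p} = m - 1"
    using S(2) by (simp add: card_image)
  moreover have "ys ! 0 = \<alpha> ! p"
    by (simp add: ys_def js_def)
  ultimately have "standardize ys ! 0 = m"
    using len_ys assms(2,3) by (simp add: standardize_def)
  then have "standardize ys \<in> first_entry_patterns k m"
    using standardize_in_Sym[OF \<open>distinct ys\<close>] len_ys by (simp add: first_entry_patterns_def)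
  moreover have "\<not> avoids \<alpha> (standardize ys)"
  proof -
    have "length (standardize ys) = k"
      by (simp add: standardize_def len_ys)
    moreover have "strict_mono_on {..<k} ((!) js)"
      using sorted len by (auto intro!: strict_mono_onI simp: sorted_wrt_iff_nth_less)
    moreover have "\<forall>a<k. js ! a < length \<alpha>"
      using js_bound len by (auto simp: subset_iff)
    moreover have "\<forall>a<k. \<forall>b<k. \<alpha> ! (js ! a) < \<alpha> ! (js ! b)
        \<longleftrightarrow> standardize ys ! a < standardize ys ! b"
      using standardize_less_iff[of _ ys] len_ys len by (simp add: ys_def)
    ultimately show ?thesis
      unfolding avoids_def by metis
  qed
  ultimately show thesis
    by (rule that)
qed

lemma avoids_first_entry_patterns_iff:
  assumes "distinct \<alpha>" and "1 \<le> m" "m \<le> k"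
  shows "(\<forall>\<tau> \<in> first_entry_patterns k m. avoids \<alpha> \<tau>) \<longleftrightarrow> uncrowded (m - 1) (k - m) \<alpha>"
proof -
  have "\<not> uncrowded (m - 1) (k - m) \<alpha> \<longleftrightarrow> (\<exists>p<length \<alpha>.
      m - 1 \<le> card {q. p < q \<and> q < length \<alpha> \<and> \<alpha> ! q < \<alpha> ! p} \<and>
      k - m \<le> card {q. p < q \<and> q < length \<alpha> \<and> \<alpha> ! p < \<alpha> ! q})"
    by (simp only: uncrowded_iff_nth[OF assms(1)] not_all not_imp de_Morgan_disj not_less)
  also have "\<dots> \<longleftrightarrow> (\<exists>\<tau> \<in> first_entry_patterns k m. \<not> avoids \<alpha> \<tau>)"
  proof
    assume "\<exists>p<length \<alpha>.
      m - 1 \<le> card {q. p < q \<and> q < length \<alpha> \<and> \<alpha> ! q < \<alpha> ! p} \<and>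
      k - m \<le> card {q. p < q \<and> q < length \<alpha> \<and> \<alpha> ! p < \<alpha> ! q}"
    then obtain p where "p < length \<alpha>"
      and "m - 1 \<le> card {q. p < q \<and> q < length \<alpha> \<and> \<alpha> ! q < \<alpha> ! p}"
      and "k - m \<le> card {q. p < q \<and> q < length \<alpha> \<and> \<alpha> ! p < \<alpha> ! q}"
      by (elim exE conjE)
    then obtain \<tau> where "\<tau> \<in> first_entry_patterns k m" "\<not> avoids \<alpha> \<tau>"
      by (rule crowded_imp_occurrence[OF assms])
    then show "\<exists>\<tau> \<in> first_entry_patterns k m. \<not> avoids \<alpha> \<tau>"
      by (intro bexI)
  next
    assume "\<exists>\<tau> \<in> first_entry_patterns k m. \<not> avoids \<alpha> \<tau>"
    then obtain \<tau> where \<tau>: "\<tau> \<in> first_entry_patterns k m" "\<not> avoids \<alpha> \<tau>"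
      by (elim bexE)
    obtain p where "p < length \<alpha>"
      and "m - 1 \<le> card {q. p < q \<and> q < length \<alpha> \<and> \<alpha> ! q < \<alpha> ! p}"
      and "k - m \<le> card {q. p < q \<and> q < length \<alpha> \<and> \<alpha> ! p < \<alpha> ! q}"
      by (rule occurrence_imp_crowded[OF \<tau>(1) assms(2,3) \<tau>(2)])
    then show "\<exists>p<length \<alpha>.
      m - 1 \<le> card {q. p < q \<and> q < length \<alpha> \<and> \<alpha> ! q < \<alpha> ! p} \<and>
      k - m \<le> card {q. p < q \<and> q < length \<alpha> \<and> \<alpha> ! p < \<alpha> ! q}"
      by (intro exI conjI)
  qed
  finally show ?thesis
    by blast
qed

section \<open>The number of avoiding permutations\<close>

theorem theorem2p1:
  fixes m k n :: nat
  assumes "2 < k" and "k \<le> n" and "1 \<le> m" and "m \<le> k"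
  shows "card (Sym_avoiding n (first_entry_patterns k m)) =
           fact (k - 2) * (k - 1) ^ (n + 2 - k)"
proof -
  have "Sym_avoiding n (first_entry_patterns k m)
      = {\<alpha> \<in> permutations_of_set {1..n}. uncrowded (m - 1) (k - m) \<alpha>}"
    using avoids_first_entry_patterns_iff[OF _ assms(3,4)]
    by (auto simp: Sym_avoiding_def Sym_def permutations_of_set_def)
  then have "card (Sym_avoiding n (first_entry_patterns k m))
      = (\<Prod>j = 1..n. min j (m - 1 + (k - m)))"
    using card_uncrowded_permutations[of "{1..n}" "m - 1" "k - m"] by simp
  also have "m - 1 + (k - m) = k - 1"
    using assms by simp
  also have "(\<Prod>j = 1..n. min j (k - 1)) = fact (k - 1) * (k - 1) ^ (n - (k - 1))"
    using assms by (intro prod_min_eq) simp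
  also have "fact (k - 1) = (k - 1) * fact (k - 2)"
    using assms fact_reduce[of "k - 1", where 'a = nat] by (simp add: numeral_2_eq_2)
  also have "(k - 1) * fact (k - 2) * (k - 1) ^ (n - (k - 1))
      = fact (k - 2) * (k - 1) ^ Suc (n - (k - 1))"
    by simp
  also have "Suc (n - (k - 1)) = n + 2 - k"
    using assms by simp
  finally show ?thesis .
qed

end
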